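(* Let $\ell\in\mathbb{N}$ (with $\ell\ge1$) and let $\tau:=\inf\{s\ge0: |Y_s|=\ell\}$, where $(Y_s)_{s\ge0}$ is a continuous-time rate-1 simple random walk on $\mathbb{Z}$. Let $\theta:=\tfrac12\pi/\ell$ and $\lambda:=1-\cos\theta$. Then, for all $s\ge0$, $$\mathbb{P}_0(\tau>s)\ge e^{-\lambda s}\ge\exp\bigl(-\tfrac18\,s\,(\pi/\ell)^2\bigr).$$
   Context: The continuous-time rate-1 simple random walk on $\mathbb{Z}$ jumps at rate 1, each jump being $+1$ or $-1$ with probability $1/2$ each. $\mathbb{P}_0$ denotes the law of the walk started at $0$. *)

theory Defs
  imports "HOL-Probability.Probability"
begin

text \<open>Holding times and steps driving the walk: all the variables are mutually independent, the
  \<open>E n\<close> are exponential with rate 1 and the \<open>\<xi> n\<close> are uniform on \<open>{-1, 1}\<close>.\<close>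

definition walk_driver ::
    "'a measure \<Rightarrow> (nat \<Rightarrow> 'a \<Rightarrow> real) \<Rightarrow> (nat \<Rightarrow> 'a \<Rightarrow> int) \<Rightarrow> bool" where
  "walk_driver M E \<xi> \<longleftrightarrow>
     prob_space.indep_vars M (\<lambda>_. borel) E UNIV \<and>
     prob_space.indep_vars M (\<lambda>_. count_space UNIV) \<xi> UNIV \<and>
     prob_space.indep_var M
       (\<Pi>\<^sub>M n\<in>UNIV. borel) (\<lambda>\<omega> n. E n \<omega>)
       (\<Pi>\<^sub>M n\<in>UNIV. count_space UNIV) (\<lambda>\<omega> n. \<xi> n \<omega>) \<and>
     (\<forall>n. distributed M lborel (E n) (exponential_density 1)) \<and>
     (\<forall>n. distr M (count_space UNIV) (\<xi> n) = measure_pmf (pmf_of_set {-1, 1}))"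

text \<open>The step \<open>\<xi> n\<close> is taken at time \<open>E 0 + \<dots> + E n\<close>. Almost surely only finitely many steps
  are taken by any given time; on the exceptional null set \<open>Y\<close> is only required to be
  right-continuous. Together with the measurability of each \<open>Y t\<close>, right-continuity of every path
  makes hitting times of \<open>Y\<close> measurable.\<close>

definition rate1_simple_random_walk ::
    "'a measure \<Rightarrow> int \<Rightarrow> (real \<Rightarrow> 'a \<Rightarrow> int) \<Rightarrow> bool" where
  "rate1_simple_random_walk M x Y \<longleftrightarrow>
     prob_space M \<and>
     (\<forall>t\<ge>0. Y t \<in> measurable M (count_space UNIV)) \<and>
     (\<forall>\<omega>\<in>space M. \<forall>t\<ge>0. continuous (at_right t) (\<lambda>u. Y u \<omega>)) \<and>
     (\<exists>E \<xi>. walk_driver M E \<xi> \<and>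
        (AE \<omega> in M. \<forall>t\<ge>0. Y t \<omega> = x + (\<Sum>n | (\<Sum>k\<le>n. E k \<omega>) \<le> t. \<xi> n \<omega>)))"

end

theory Submission
  imports Defs
begin

text \<open>
  The cosine \<open>x \<mapsto> cos (\<theta> x)\<close> with \<open>\<theta> = \<pi> / (2 l)\<close> is an eigenfunction of the simple random walk: the
  average of its values at \<open>x - 1\<close> and \<open>x + 1\<close> is \<open>cos \<theta>\<close> times its value at \<open>x\<close>. It vanishes at the
  boundary points \<open>l\<close> and \<open>-l\<close> of the interval in which the walk has to survive, so killing the
  discrete walk at the boundary preserves the eigenvalue equation, and the expectation of the cosine
  of the killed walk after \<open>n\<close> steps is \<open>cos \<theta> ^ n\<close> (\<open>expectation_confined_cos\<close>). As the cosine is at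
  most 1, the discrete walk stays inside for \<open>n\<close> steps with probability at least \<open>cos \<theta> ^ n\<close>
  (\<open>prob_confined_ge\<close>).

  The number of jumps by time \<open>s\<close> is Poisson with mean \<open>s\<close> (\<open>prob_jump_count\<close>) and independent of the
  steps. Summing over its value (\<open>prob_ge_poisson_mixture\<close>) gives
  \<open>P (\<tau> > s) \<ge> (\<Sum>n. exp (- s) * s ^ n / fact n * cos \<theta> ^ n) = exp (- (1 - cos \<theta>) * s)\<close>.
  The second inequality is \<open>1 - cos \<theta> \<le> \<theta>\<^sup>2 / 2\<close>.

  The event \<open>\<tau> > s\<close> involves uncountably many times. Right-continuity reduces it to rational times
  (\<open>gt_hitting_time_iff\<close>), which makes it measurable, so that its probability can be bounded from
  below by that of a subset.
\<close>

section \<open>Confinement of the embedded discrete walk\<close>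

definition confined :: "nat \<Rightarrow> nat \<Rightarrow> (nat \<Rightarrow> int) \<Rightarrow> bool" where
  "confined l n x \<longleftrightarrow> (\<forall>k\<le>n. \<bar>\<Sum>i<k. x i\<bar> < int l)"

lemma confined_Suc: "confined l (Suc n) x \<longleftrightarrow> confined l n x \<and> \<bar>\<Sum>i<Suc n. x i\<bar> < int l"
  unfolding confined_def using le_Suc_eq by auto

lemma measurable_partial_sum:
  fixes k :: nat
  assumes "{..<k} \<subseteq> I"
  shows "(\<lambda>x. \<Sum>i<k. x i) \<in> measurable (\<Pi>\<^sub>M i\<in>I. count_space (UNIV :: int set)) (count_space (UNIV :: int set))"
  using assms
proof (induction k)
  case (Suc k)
  have "{..<k} \<subseteq> I" "k \<in> I" using Suc.prems by auto
  let ?P = "\<Pi>\<^sub>M i\<in>I. count_space (UNIV :: int set)"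
  have sum_k: "(\<lambda>x. \<Sum>i<k. x i) \<in> measurable ?P (count_space UNIV)"
    by (rule Suc.IH) fact
  have x_k: "(\<lambda>x. x k) \<in> measurable ?P (count_space UNIV)"
    by (rule measurable_component_singleton) fact
  have "(\<lambda>x. (\<Sum>i<k. x i) + x k) \<in> measurable ?P (count_space (UNIV :: int set))"
    by (rule measurable_compose_countable[OF _ sum_k, where f="\<lambda>a x. a + x k"])
       (rule measurable_compose[OF x_k], simp)
  then show ?case by simp
qed simp

lemma measurable_confined:
  assumes "{..<n} \<subseteq> I"
  shows "Measurable.pred (\<Pi>\<^sub>M i\<in>I. count_space (UNIV :: int set)) (confined l n)"
proof -
  have "Measurable.pred (\<Pi>\<^sub>M i\<in>I. count_space (UNIV :: int set)) (\<lambda>x. \<bar>\<Sum>i<k. x i\<bar> < int l)"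
    if "k \<le> n" for k
    using assms that by (intro measurable_compose[OF measurable_partial_sum]) auto
  then have "Measurable.pred (\<Pi>\<^sub>M i\<in>I. count_space (UNIV :: int set)) (\<lambda>x. \<forall>k\<in>{..n}. \<bar>\<Sum>i<k. x i\<bar> < int l)"
    by (intro pred_intros_finite(3)) simp_all
  also have "(\<lambda>x. \<forall>k\<in>{..n}. \<bar>\<Sum>i<k. x i\<bar> < int l) = confined l n"
    unfolding confined_def fun_eq_iff by auto
  finally show ?thesis .
qed

lemma
  fixes X :: "nat \<Rightarrow> 'a \<Rightarrow> int"
  assumes X: "\<And>i. X i \<in> measurable M (count_space UNIV)"
  shows measurable_partial_sum_process: "(\<lambda>\<omega>. \<Sum>i<n. X i \<omega>) \<in> measurable M (count_space UNIV)"
    and measurable_confined_process: "Measurable.pred M (\<lambda>\<omega>. confined l n (\<lambda>i. X i \<omega>))"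
proof -
  have paths: "(\<lambda>\<omega> i. X i \<omega>) \<in> measurable M (\<Pi>\<^sub>M i\<in>UNIV. count_space UNIV)"
    using X by (intro measurable_PiM_single') auto
  show "(\<lambda>\<omega>. \<Sum>i<n. X i \<omega>) \<in> measurable M (count_space UNIV)"
    using measurable_compose[OF paths measurable_partial_sum[of n UNIV]] by simp
  show "Measurable.pred M (\<lambda>\<omega>. confined l n (\<lambda>i. X i \<omega>))"
    using measurable_compose[OF paths measurable_confined[of n UNIV]] by simp
qed

lemma (in prob_space) expectation_sign:
  fixes X :: "'a \<Rightarrow> int" and f :: "int \<Rightarrow> real"
  assumes X: "X \<in> measurable M (count_space UNIV)"
    and d: "distr M (count_space UNIV) X = measure_pmf (pmf_of_set {-1, 1})"
  shows "expectation (\<lambda>\<omega>. f (X \<omega>)) = (f (-1) + f 1) / 2"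
proof -
  have "expectation (\<lambda>\<omega>. f (X \<omega>)) = (\<integral>x. f x \<partial>distr M (count_space UNIV) X)"
    using X by (subst integral_distr) auto
  also have "\<dots> = (f (-1) + f 1) / 2"
    unfolding d by (subst integral_pmf_of_set) auto
  finally show ?thesis .
qed

text \<open>
  Induction on \<open>n\<close>. By the addition theorem, \<open>cos (\<theta> X\<^sub>n\<^sub>+\<^sub>1)\<close> splits into a cosine and a sine part, each
  a product of a function of the first \<open>n\<close> steps and one of the independent next step. The sine part
  has mean 0 by symmetry of the step, and the cosine part picks up the factor \<open>cos \<theta>\<close>. Requiring
  confinement at time \<open>n + 1\<close> as well changes nothing: a walk leaving the interval at that moment is
  at \<open>l\<close> or \<open>-l\<close>, where the cosine is 0.
\<close>

lemma (in prob_space) expectation_confined_cos: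
  fixes \<xi> :: "nat \<Rightarrow> 'a \<Rightarrow> int"
  assumes ind: "indep_vars (\<lambda>_. count_space UNIV) \<xi> UNIV"
    and law: "\<And>n. distr M (count_space UNIV) (\<xi> n) = measure_pmf (pmf_of_set {-1, 1})"
    and l: "l \<ge> 1"
    and theta: "\<theta> = pi / (2 * real l)"
  shows "expectation (\<lambda>\<omega>. of_bool (confined l n (\<lambda>i. \<xi> i \<omega>)) * cos (\<theta> * (\<Sum>i<n. \<xi> i \<omega>))) = cos \<theta> ^ n"
proof (induction n)
  case 0
  then show ?case using l by (simp add: confined_def prob_space)
next
  case (Suc n)
  let ?c = "\<lambda>\<omega>. of_bool (confined l n (\<lambda>i. \<xi> i \<omega>)) :: real"
  let ?X = "\<lambda>n \<omega>. \<Sum>i<n. \<xi> i \<omega>"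
  have meas [measurable]: "\<xi> i \<in> measurable M (count_space UNIV)" for i
    using ind by (auto simp: indep_vars_def)
  have law_AE: "AE \<omega> in M. \<xi> n \<omega> \<in> {-1, 1}"
  proof -
    have "AE x in distr M (count_space UNIV) (\<xi> n). x \<in> {-1, 1}"
      unfolding law by (auto simp: AE_measure_pmf_iff)
    then show ?thesis by (subst (asm) AE_distr_iff) auto
  qed
  have factor: "expectation (\<lambda>\<omega>. (?c \<omega> * f (?X n \<omega>)) * g (\<xi> n \<omega>)) =
        expectation (\<lambda>\<omega>. ?c \<omega> * f (?X n \<omega>)) * ((g (-1) + g 1) / 2)"
      and int1: "integrable M (\<lambda>\<omega>. (?c \<omega> * f (?X n \<omega>)) * g (\<xi> n \<omega>))"
    if f: "\<And>x. \<bar>f x\<bar> \<le> 1" and g: "\<And>x. \<bar>g x\<bar> \<le> 1" for f g :: "int \<Rightarrow> real"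
  proof -
    let ?P = "\<lambda>A. \<Pi>\<^sub>M i\<in>A. count_space (UNIV :: int set)"
    have 0: "indep_var (?P {..<n}) (\<lambda>\<omega>. restrict (\<lambda>i. \<xi> i \<omega>) {..<n}) (?P {n}) (\<lambda>\<omega>. restrict (\<lambda>i. \<xi> i \<omega>) {n})"
      by (rule indep_var_restrict[OF ind]) auto
    have [measurable]: "(\<lambda>x. \<Sum>i<n. x i) \<in> measurable (?P {..<n}) (count_space UNIV)"
      "Measurable.pred (?P {..<n}) (confined l n)"
      by (rule measurable_partial_sum measurable_confined; simp)+
    have 1: "indep_var borel ((\<lambda>x. of_bool (confined l n x) * f (\<Sum>i<n. x i)) \<circ> (\<lambda>\<omega>. restrict (\<lambda>i. \<xi> i \<omega>) {..<n}))
       borel ((\<lambda>x. g (x n)) \<circ> (\<lambda>\<omega>. restrict (\<lambda>i. \<xi> i \<omega>) {n}))"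
      by (rule indep_var_compose[OF 0]) measurable
    have 2: "((\<lambda>x. of_bool (confined l n x) * f (\<Sum>i<n. x i)) \<circ> (\<lambda>\<omega>. restrict (\<lambda>i. \<xi> i \<omega>) {..<n}))
       = (\<lambda>\<omega>. ?c \<omega> * f (?X n \<omega>))"
    proof -
      have "(\<Sum>i<k. restrict (\<lambda>i. \<xi> i \<omega>) {..<n} i) = ?X k \<omega>" if "k \<le> n" for k \<omega>
        using that by (intro sum.cong) auto
      then show ?thesis by (auto simp: fun_eq_iff confined_def)
    qed
    have 3: "((\<lambda>x. g (x n)) \<circ> (\<lambda>\<omega>. restrict (\<lambda>i. \<xi> i \<omega>) {n})) = (\<lambda>\<omega>. g (\<xi> n \<omega>))"
      by (auto simp: fun_eq_iff)
    have ind2: "indep_var borel (\<lambda>\<omega>. ?c \<omega> * f (?X n \<omega>)) borel (\<lambda>\<omega>. g (\<xi> n \<omega>))"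
      using 1 unfolding 2 3 .
    have i1: "integrable M (\<lambda>\<omega>. ?c \<omega> * f (?X n \<omega>))"
      using f by (intro integrable_const_bound[where B=1] indep_var_rv1[OF ind2]) (auto simp: abs_mult)
    have i2: "integrable M (\<lambda>\<omega>. g (\<xi> n \<omega>))"
      using g by (intro integrable_const_bound[where B=1] indep_var_rv2[OF ind2]) auto
    show "expectation (\<lambda>\<omega>. (?c \<omega> * f (?X n \<omega>)) * g (\<xi> n \<omega>)) =
        expectation (\<lambda>\<omega>. ?c \<omega> * f (?X n \<omega>)) * ((g (-1) + g 1) / 2)"
      using indep_var_lebesgue_integral[OF ind2 i1 i2] expectation_sign[OF meas law, of g n] by simp
    show "integrable M (\<lambda>\<omega>. (?c \<omega> * f (?X n \<omega>)) * g (\<xi> n \<omega>))"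
      by (rule indep_var_integrable[OF ind2 i1 i2])
  qed
  note cc = factor[of "\<lambda>x. cos (\<theta> * x)" "\<lambda>x. cos (\<theta> * x)"] int1[of "\<lambda>x. cos (\<theta> * x)" "\<lambda>x. cos (\<theta> * x)"]
  note ss = factor[of "\<lambda>x. sin (\<theta> * x)" "\<lambda>x. sin (\<theta> * x)"] int1[of "\<lambda>x. sin (\<theta> * x)" "\<lambda>x. sin (\<theta> * x)"]
  have lt: "\<theta> * l = pi / 2" using theta l by simp
  \<comment> \<open>The addition theorem, together with the vanishing of the cosine on the boundary.\<close>
  have key: "of_bool (confined l (Suc n) (\<lambda>i. \<xi> i \<omega>)) * cos (\<theta> * ?X (Suc n) \<omega>)
      = (?c \<omega> * cos (\<theta> * ?X n \<omega>)) * cos (\<theta> * \<xi> n \<omega>) - (?c \<omega> * sin (\<theta> * ?X n \<omega>)) * sin (\<theta> * \<xi> n \<omega>)"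
    if st: "\<xi> n \<omega> \<in> {-1, 1}" for \<omega>
  proof (cases "confined l n (\<lambda>i. \<xi> i \<omega>)")
    case True
    have e: "(?c \<omega> * cos (\<theta> * ?X n \<omega>)) * cos (\<theta> * \<xi> n \<omega>) - (?c \<omega> * sin (\<theta> * ?X n \<omega>)) * sin (\<theta> * \<xi> n \<omega>)
      = cos (\<theta> * ?X (Suc n) \<omega>)"
      using True by (simp add: cos_add distrib_left)
    have "cos (\<theta> * ?X (Suc n) \<omega>) = 0" if "\<not> confined l (Suc n) (\<lambda>i. \<xi> i \<omega>)"
    proof -
      have "\<bar>?X n \<omega>\<bar> < int l" using True by (simp add: confined_def)
      moreover have "\<not> \<bar>?X (Suc n) \<omega>\<bar> < int l" using True that confined_Suc by blast
      ultimately have "?X (Suc n) \<omega> = int l \<or> ?X (Suc n) \<omega> = - int l"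
        using st by auto
      then have "real_of_int (?X (Suc n) \<omega>) = real l \<or> real_of_int (?X (Suc n) \<omega>) = - real l"
        by (metis of_int_minus of_int_of_nat_eq)
      then show ?thesis
        by (rule disjE) (simp_all only: lt cos_pi_half cos_minus mult_minus_right)
    qed
    then show ?thesis unfolding e by auto
  next
    case False
    then show ?thesis by (simp add: confined_Suc)
  qed
  have "expectation (\<lambda>\<omega>. of_bool (confined l (Suc n) (\<lambda>i. \<xi> i \<omega>)) * cos (\<theta> * ?X (Suc n) \<omega>))
    = expectation (\<lambda>\<omega>. (?c \<omega> * cos (\<theta> * ?X n \<omega>)) * cos (\<theta> * \<xi> n \<omega>) - (?c \<omega> * sin (\<theta> * ?X n \<omega>)) * sin (\<theta> * \<xi> n \<omega>))"
  proof (rule integral_cong_AE)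
    note measurable_confined_process[OF meas, measurable]
    note measurable_partial_sum_process[OF meas, measurable]
    show "(\<lambda>\<omega>. of_bool (confined l (Suc n) (\<lambda>i. \<xi> i \<omega>)) * cos (\<theta> * ?X (Suc n) \<omega>)) \<in> borel_measurable M"
      by measurable
    show "(\<lambda>\<omega>. (?c \<omega> * cos (\<theta> * ?X n \<omega>)) * cos (\<theta> * \<xi> n \<omega>) - (?c \<omega> * sin (\<theta> * ?X n \<omega>)) * sin (\<theta> * \<xi> n \<omega>))
        \<in> borel_measurable M"
      by measurable
    show "AE \<omega> in M. of_bool (confined l (Suc n) (\<lambda>i. \<xi> i \<omega>)) * cos (\<theta> * ?X (Suc n) \<omega>) =
        (?c \<omega> * cos (\<theta> * ?X n \<omega>)) * cos (\<theta> * \<xi> n \<omega>) - (?c \<omega> * sin (\<theta> * ?X n \<omega>)) * sin (\<theta> * \<xi> n \<omega>)"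
      using law_AE by eventually_elim (rule key)
  qed
  also have "\<dots> = expectation (\<lambda>\<omega>. ?c \<omega> * cos (\<theta> * ?X n \<omega>)) * cos \<theta>"
    using cc ss by simp
  finally show ?case using Suc.IH by (simp add: mult.commute)
qed

lemma (in prob_space) prob_confined_ge:
  fixes \<xi> :: "nat \<Rightarrow> 'a \<Rightarrow> int"
  assumes ind: "indep_vars (\<lambda>_. count_space UNIV) \<xi> UNIV"
    and law: "\<And>n. distr M (count_space UNIV) (\<xi> n) = measure_pmf (pmf_of_set {-1, 1})"
    and l: "l \<ge> 1"
  shows "cos (pi / (2 * real l)) ^ n \<le> \<P>(\<omega> in M. confined l n (\<lambda>i. \<xi> i \<omega>))"
proof -
  define \<theta> where "\<theta> = pi / (2 * real l)"
  have meas [measurable]: "\<xi> i \<in> measurable M (count_space UNIV)" for i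
    using ind by (auto simp: indep_vars_def)
  note measurable_confined_process[OF meas, measurable]
  note measurable_partial_sum_process[OF meas, measurable]
  have "cos \<theta> ^ n = expectation (\<lambda>\<omega>. of_bool (confined l n (\<lambda>i. \<xi> i \<omega>)) * cos (\<theta> * (\<Sum>i<n. \<xi> i \<omega>)))"
    using expectation_confined_cos[OF ind law l \<theta>_def, of n] by simp
  also have "\<dots> \<le> expectation (indicator {\<omega>\<in>space M. confined l n (\<lambda>i. \<xi> i \<omega>)})"
  proof (rule integral_mono)
    show "integrable M (\<lambda>\<omega>. of_bool (confined l n (\<lambda>i. \<xi> i \<omega>)) * cos (\<theta> * (\<Sum>i<n. \<xi> i \<omega>)))"
      by (intro integrable_const_bound[where B=1]) (auto simp: abs_mult)
    show "integrable M (indicat_real {\<omega>\<in>space M. confined l n (\<lambda>i. \<xi> i \<omega>)})"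
      by (intro integrable_real_indicator) (auto simp: emeasure_eq_measure)
  qed (auto simp: indicator_def)
  also have "\<dots> = \<P>(\<omega> in M. confined l n (\<lambda>i. \<xi> i \<omega>))"
    by simp
  finally show ?thesis by (simp add: \<theta>_def)
qed

section \<open>The number of jumps is Poisson distributed\<close>

lemma (in prob_space) AE_exponential_pos:
  assumes "distributed M lborel X (exponential_density 1)"
  shows "AE \<omega> in M. 0 < X \<omega>"
  using AE_prob_1[of "{\<omega>\<in>space M. 0 < X \<omega>}"] exponential_distributedD_gt[OF assms, of 0] by simp

text \<open>
  The \<open>m\<close>-th arrival time is Erlang distributed, so the probability that it exceeds \<open>s\<close> is the partial
  sum of the first \<open>m\<close> Poisson weights. Arrival times increase, hence the probability that \<open>s\<close> lies
  between two consecutive ones is the difference of two such partial sums.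
\<close>

lemma (in prob_space) prob_jump_count:
  fixes E :: "nat \<Rightarrow> 'a \<Rightarrow> real"
  assumes ind: "indep_vars (\<lambda>_. borel) E UNIV"
    and expo: "\<And>n. distributed M lborel (E n) (exponential_density 1)"
    and s: "s \<ge> 0"
  shows "\<P>(\<omega> in M. (\<Sum>k<n. E k \<omega>) \<le> s \<and> s < (\<Sum>k<Suc n. E k \<omega>)) = exp (-s) * s ^ n / fact n"
proof -
  have [measurable]: "E i \<in> borel_measurable M" for i
    using ind by (auto simp: indep_vars_def)
  have tail: "\<P>(\<omega> in M. s < (\<Sum>k<m. E k \<omega>)) = (\<Sum>k<m. exp (-s) * s ^ k / fact k)" for m
  proof (cases m)
    case 0
    then show ?thesis using s by simp
  next
    case (Suc j)
    have "distributed M lborel (\<lambda>\<omega>. \<Sum>k\<in>{..<m}. E k \<omega>) (erlang_density (card {..<m} - 1) 1)"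
      using Suc by (intro exponential_distributed_sum expo indep_vars_subset[OF ind]) auto
    then have "\<P>(\<omega> in M. s < (\<Sum>k<m. E k \<omega>)) = 1 - erlang_CDF j 1 s"
      using erlang_distributed_gt[of "\<lambda>\<omega>. \<Sum>k\<in>{..<m}. E k \<omega>" j 1 s] s Suc by simp
    then show ?thesis using s Suc 
      by (simp add: erlang_CDF_def lessThan_Suc_atMost mult.commute)
  qed
  have pos: "AE \<omega> in M. 0 < E n \<omega>"
    by (rule AE_exponential_pos[OF expo])
  have "\<P>(\<omega> in M. s < (\<Sum>k<Suc n. E k \<omega>)) = 
     prob ({\<omega>\<in>space M. s < (\<Sum>k<n. E k \<omega>)} \<union> {\<omega>\<in>space M. (\<Sum>k<n. E k \<omega>) \<le> s \<and> s < (\<Sum>k<Suc n. E k \<omega>)})"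
    using pos by (intro finite_measure_eq_AE) auto
  also have "\<dots> = \<P>(\<omega> in M. s < (\<Sum>k<n. E k \<omega>)) + \<P>(\<omega> in M. (\<Sum>k<n. E k \<omega>) \<le> s \<and> s < (\<Sum>k<Suc n. E k \<omega>))"
    by (intro finite_measure_Union) auto
  finally show ?thesis unfolding tail by simp
qed

section \<open>Hitting times of right-continuous integer paths\<close>

text \<open>
  A right-continuous integer path that takes a value keeps it for a short while, and so takes it at a
  rational time too. The margin \<open>1 / Suc m\<close> is what makes the infimum strictly larger than \<open>s\<close>.
\<close>

lemma gt_hitting_time_iff:
  fixes y :: "real \<Rightarrow> int"
  assumes s: "s \<ge> 0"
    and rc: "\<And>t. t \<ge> 0 \<Longrightarrow> continuous (at_right t) y"
  shows "ereal s < Inf {ereal t | t. 0 \<le> t \<and> \<bar>y t\<bar> = a} \<longleftrightarrow>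
    (\<exists>m::nat. \<forall>q::rat. 0 \<le> q \<and> of_rat q < s + 1 / Suc m \<longrightarrow> \<bar>y (of_rat q)\<bar> \<noteq> a)"
    (is "ereal s < Inf ?H \<longleftrightarrow> ?R")
proof
  assume "ereal s < Inf ?H"
  then obtain u where u: "ereal s < ereal u" "ereal u < Inf ?H"
    using ereal_dense2 by blast
  then obtain m where m: "1 / Suc m < u - s"
    by (metis diff_gt_0_iff_gt less_ereal.simps(1) nat_approx_posE)
  have "\<bar>y (of_rat q)\<bar> \<noteq> a" if q: "0 \<le> q \<and> of_rat q < s + 1 / Suc m" for q
  proof
    assume "\<bar>y (of_rat q)\<bar> = a"
    then have "Inf ?H \<le> ereal (of_rat q)"
      using q by (intro Inf_lower) auto
    with u have "ereal u < ereal (of_rat q)" using order.strict_trans2 by blast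
    then show False using q m by auto
  qed
  then show ?R by blast
next
  assume ?R
  then obtain m :: nat where m: "\<And>q::rat. 0 \<le> q \<Longrightarrow> of_rat q < s + 1 / Suc m \<Longrightarrow> \<bar>y (of_rat q)\<bar> \<noteq> a"
    by blast
  have "ereal (s + 1 / Suc m) \<le> Inf ?H"
  proof (rule Inf_greatest)
    fix h assume "h \<in> ?H"
    then obtain t where t: "h = ereal t" "0 \<le> t" "\<bar>y t\<bar> = a" by blast
    show "ereal (s + 1 / Suc m) \<le> h"
    proof (rule ccontr)
      assume "\<not> ?thesis"
      then have ts: "t < s + 1 / Suc m" using t by simp
      have "(y \<longlongrightarrow> y t) (at_right t)"
        using rc[OF t(2)] by (simp add: continuous_within)
      then have "eventually (\<lambda>u. y u = y t) (at_right t)"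
        using tendsto_discrete by blast
      moreover have "eventually (\<lambda>u. u < s + 1 / Suc m) (at_right t)"
        using order_tendstoD(2)[OF tendsto_ident_at ts] .
      ultimately have "eventually (\<lambda>u. y u = y t \<and> u < s + 1 / Suc m) (at_right t)"
        by (rule eventually_conj)
      then obtain b where b: "b > t" "\<And>u. t < u \<Longrightarrow> u < b \<Longrightarrow> y u = y t \<and> u < s + 1 / Suc m"
        unfolding eventually_at_right_field by blast
      obtain q where q: "t < of_rat q" "of_rat q < b" using of_rat_dense[OF b(1)] by blast
      then have "0 \<le> q" using t(2) by (metis le_less_trans less_imp_le zero_less_of_rat_iff)
      then show False using m[of q] b(2)[OF q] t(3) by auto
    qed
  qed
  moreover have "ereal s < ereal (s + 1 / Suc m)" by simp
  ultimately show "ereal s < Inf ?H" by (rule order.strict_trans2[rotated])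
qed

text \<open>
  Before the arrival of jump number \<open>n + 1\<close> the path only visits partial sums of at most \<open>n\<close> steps, so
  the hitting time is at least that arrival time.
\<close>

lemma hitting_time_confined_gt:
  fixes y :: "real \<Rightarrow> int" and e :: "nat \<Rightarrow> real" and x :: "nat \<Rightarrow> int"
  assumes e: "\<And>k. 0 \<le> e k"
    and y: "\<And>t. t \<ge> 0 \<Longrightarrow> y t = (\<Sum>n | (\<Sum>k\<le>n. e k) \<le> t. x n)"
    and n: "s < (\<Sum>k<Suc n. e k)"
    and c: "confined l n x"
  shows "ereal s < Inf {ereal t | t. 0 \<le> t \<and> \<bar>y t\<bar> = int l}"
proof -
  let ?T = "\<lambda>m. \<Sum>k<m. e k"
  have mono: "?T i \<le> ?T j" if "i \<le> j" for i j
    using that e by (intro sum_mono2) auto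
  have "ereal (?T (Suc n)) \<le> Inf {ereal t | t. 0 \<le> t \<and> \<bar>y t\<bar> = int l}"
  proof (rule Inf_greatest)
    fix h assume "h \<in> {ereal t | t. 0 \<le> t \<and> \<bar>y t\<bar> = int l}"
    then obtain t where t: "h = ereal t" "0 \<le> t" "\<bar>y t\<bar> = int l" by blast
    show "ereal (?T (Suc n)) \<le> h"
    proof (rule ccontr)
      assume "\<not> ?thesis"
      then have tT: "t < ?T (Suc n)" using t by simp
      \<comment> \<open>\<open>j\<close> is the number of jumps made by time \<open>t\<close>.\<close>
      define j where "j = (LEAST j. t < ?T (Suc j))"
      have j1: "t < ?T (Suc j)" unfolding j_def using tT by (rule LeastI)
      have j2: "j \<le> n" unfolding j_def using tT by (rule Least_le)
      have "(?T (Suc m) \<le> t) = (m < j)" for m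
      proof
        assume "?T (Suc m) \<le> t"
        then show "m < j" using j1 mono[of "Suc j" "Suc m"] by (meson Suc_le_mono leD le_less_trans not_le_imp_less)
      next
        assume "m < j"
        then show "?T (Suc m) \<le> t" unfolding j_def using not_less_Least not_le_imp_less by blast
      qed
      then have "{m. (\<Sum>k\<le>m. e k) \<le> t} = {..<j}"
        by (auto simp: lessThan_Suc_atMost)
      then have "y t = (\<Sum>i<j. x i)" using y[OF t(2)] by simp
      then show False using c j2 t(3) by (auto simp: confined_def)
    qed
  qed
  then show ?thesis using n by (meson ereal_less_eq(3) less_ereal.simps(1) order.strict_trans2)
qed

section \<open>Survival probability\<close>

text \<open>
  The hypothesis on \<open>A\<close> says that, up to null sets, \<open>A\<close> contains for each \<open>n\<close> the event that exactly \<open>n\<close>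
  jumps occur by time \<open>s\<close> and the walk stays confined during them. These events are almost surely disjoint, and each
  factors by independence of holding times and steps, so their union has at least the mass of a
  Poisson mixture of the powers of \<open>cos (\<pi> / (2 l))\<close>.
\<close>

lemma (in prob_space) prob_ge_poisson_mixture:
  fixes E :: "nat \<Rightarrow> 'a \<Rightarrow> real" and \<xi> :: "nat \<Rightarrow> 'a \<Rightarrow> int"
  assumes driver: "walk_driver M E \<xi>"
    and s: "s \<ge> 0" and l: "l \<ge> 1"
    and A: "A \<in> events"
    and sub: "\<And>n. AE \<omega> in M. (\<Sum>k<n. E k \<omega>) \<le> s \<and> s < (\<Sum>k<Suc n. E k \<omega>) \<and>
      confined l n (\<lambda>i. \<xi> i \<omega>) \<longrightarrow> \<omega> \<in> A"
  shows "exp (- (1 - cos (pi / (2 * real l))) * s) \<le> prob A"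
proof -
  let ?c = "cos (pi / (2 * real l))"
  from driver have indE: "indep_vars (\<lambda>_. borel) E UNIV"
    and ind\<xi>: "indep_vars (\<lambda>_. count_space UNIV) \<xi> UNIV"
    and indE\<xi>: "indep_var (\<Pi>\<^sub>M n\<in>UNIV. borel) (\<lambda>\<omega> n. E n \<omega>)
       (\<Pi>\<^sub>M n\<in>UNIV. count_space UNIV) (\<lambda>\<omega> n. real_of_int (\<xi> n \<omega>))"
    and expo: "\<And>n. distributed M lborel (E n) (exponential_density 1)"
    and law: "\<And>n. distr M (count_space UNIV) (\<xi> n) = measure_pmf (pmf_of_set {-1, 1})"
    by (auto simp: walk_driver_def)
  have [measurable]: "E i \<in> borel_measurable M" for i
    using indE by (auto simp: indep_vars_def)
  have meas [measurable]: "\<xi> i \<in> measurable M (count_space UNIV)" for i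
    using ind\<xi> by (auto simp: indep_vars_def)
  note measurable_confined_process[OF meas, measurable]
  note A [measurable]
  let ?J = "\<lambda>n \<omega>. (\<Sum>k<n. E k \<omega>) \<le> s \<and> s < (\<Sum>k<Suc n. E k \<omega>)"
  let ?C = "\<lambda>n \<omega>. confined l n (\<lambda>i. \<xi> i \<omega>)"
  \<comment> \<open>Positivity of the holding times is built in so that the events are disjoint
    everywhere, and not just almost everywhere.\<close>
  define B where "B n = {\<omega>\<in>space M. ?J n \<omega> \<and> ?C n \<omega> \<and> \<omega> \<in> A \<and> (\<forall>k. 0 < E k \<omega>)}" for n
  have B [measurable]: "B n \<in> events" for n
    unfolding B_def by measurable
  have pos: "AE \<omega> in M. \<forall>k. 0 < E k \<omega>"
    using AE_exponential_pos[OF expo] by (simp add: AE_all_countable)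
  have lower: "exp (-s) * s ^ n / fact n * ?c ^ n \<le> prob (B n)" for n
  proof -
    let ?U = "{e \<in> space (\<Pi>\<^sub>M n\<in>(UNIV::nat set). (borel :: real measure)). (\<Sum>k<n. e k) \<le> s \<and> s < (\<Sum>k<Suc n. e k)}"
    \<comment> \<open>The independence hypothesis views the steps as real numbers, whence the floor.\<close>
    let ?V = "{x \<in> space (\<Pi>\<^sub>M n\<in>(UNIV::nat set). count_space (UNIV :: real set)). confined l n (\<lambda>i. \<lfloor>x i\<rfloor>)}"
    have U: "?U \<in> sets (\<Pi>\<^sub>M n\<in>UNIV. borel)" by measurable
    have [measurable]: "Measurable.pred (\<Pi>\<^sub>M i\<in>UNIV. count_space (UNIV :: int set)) (confined l n)"
      by (rule measurable_confined) simp
    have [measurable]: "(\<lambda>x i. \<lfloor>x i\<rfloor>) \<in> measurable (\<Pi>\<^sub>M i\<in>(UNIV::nat set). count_space (UNIV :: real set))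
        (\<Pi>\<^sub>M i\<in>UNIV. count_space (UNIV :: int set))"
    proof (rule measurable_PiM_single')
      fix i :: nat
      have "(\<lambda>x. x i) \<in> measurable (\<Pi>\<^sub>M i\<in>(UNIV::nat set). count_space (UNIV :: real set)) (count_space UNIV)"
        by (rule measurable_component_singleton) simp
      then show "(\<lambda>x. \<lfloor>x i\<rfloor>) \<in> measurable (\<Pi>\<^sub>M i\<in>(UNIV::nat set). count_space (UNIV :: real set)) (count_space UNIV)"
        by (rule measurable_compose) simp
    qed (simp add: space_PiM)
    have V: "?V \<in> sets (\<Pi>\<^sub>M n\<in>UNIV. count_space UNIV)" by measurable
    have "exp (-s) * s ^ n / fact n * ?c ^ n \<le> \<P>(\<omega> in M. ?J n \<omega>) * \<P>(\<omega> in M. ?C n \<omega>)"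
      unfolding prob_jump_count[OF indE expo s]
      using s by (intro mult_left_mono prob_confined_ge[OF ind\<xi> law l]) auto
    also have "\<dots> = prob ((\<lambda>\<omega>. (\<lambda>n. E n \<omega>, \<lambda>n. real_of_int (\<xi> n \<omega>))) -` (?U \<times> ?V) \<inter> space M)"
      unfolding indep_varD[OF indE\<xi> U V]
      by (intro arg_cong2[where f="(*)"] arg_cong[where f=prob]) (auto simp: space_PiM)
    also have "\<dots> = prob {\<omega>\<in>space M. ?J n \<omega> \<and> ?C n \<omega>}"
      by (intro arg_cong[where f=prob]) (auto simp: space_PiM)
    also have "\<dots> = prob (B n)"
      using sub[of n] pos by (intro finite_measure_eq_AE) (auto simp: B_def)
    finally show ?thesis .
  qed
  have "disjoint_family B"
    unfolding disjoint_family_on_def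
  proof (intro ballI impI)
    fix m n :: nat assume "m \<noteq> n"
    have False if "i < j" and w: "\<omega> \<in> B i" "\<omega> \<in> B j" for i j \<omega>
    proof -
      have "(\<Sum>k<Suc i. E k \<omega>) \<le> (\<Sum>k<j. E k \<omega>)"
        using that by (intro sum_mono2) (auto simp: B_def less_imp_le)
      with w show False by (auto simp: B_def)
    qed
    with \<open>m \<noteq> n\<close> show "B m \<inter> B n = {}"
      by (metis disjoint_iff linorder_neqE_nat)
  qed
  then have B_sums: "(\<lambda>n. prob (B n)) sums prob (\<Union>n. B n)"
    using B by (intro finite_measure_UNION) auto
  have "(\<lambda>n. exp (-s) * ((s * ?c) ^ n /\<^sub>R fact n)) sums (exp (-s) * exp (s * ?c))"
    by (intro sums_mult exp_converges)
  then have "exp (-s) * exp (s * ?c) \<le> prob (\<Union>n. B n)"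
    by (rule sums_le[OF _ _ B_sums, rotated])
       (use lower in \<open>simp add: power_mult_distrib field_simps\<close>)
  also have "\<dots> \<le> prob A"
    by (intro finite_measure_mono) (auto simp: B_def A)
  finally show ?thesis by (simp add: exp_add[symmetric] algebra_simps)
qed

lemma one_minus_cos_le: "1 - cos x \<le> x\<^sup>2 / 2" for x :: real
proof -
  have "1 - cos x = 2 * (sin (x / 2))\<^sup>2"
    using cos_double_sin[of "x / 2"] by simp
  also have "\<dots> \<le> 2 * (x / 2)\<^sup>2"
    using abs_sin_x_le_abs_x[of "x / 2", unfolded abs_le_square_iff] by (intro mult_left_mono) auto
  finally show ?thesis by (simp add: power2_eq_square)
qed

theorem lemmaD2:
  fixes M :: "'a measure" and Y :: "real \<Rightarrow> 'a \<Rightarrow> int"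
    and l :: nat and \<tau> :: "'a \<Rightarrow> ereal" and \<theta> lam s :: real
  assumes walk: "rate1_simple_random_walk M 0 Y"
    and l: "l \<ge> 1"
    and tau: "\<And>\<omega>. \<tau> \<omega> = Inf {ereal t | t. 0 \<le> t \<and> \<bar>Y t \<omega>\<bar> = int l}"
    and theta: "\<theta> = 1 / 2 * pi / real l"
    and lam: "lam = 1 - cos \<theta>"
    and s: "s \<ge> 0"
  shows "\<P>(\<omega> in M. \<tau> \<omega> > ereal s) \<ge> exp (- lam * s) \<and>
         exp (- lam * s) \<ge> exp (- (1 / 8) * s * (pi / real l)\<^sup>2)"
proof
  from walk have "prob_space M" by (simp add: rate1_simple_random_walk_def)
  then interpret prob_space M .
  from walk obtain E \<xi> where driver: "walk_driver M E \<xi>"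
    and Y: "AE \<omega> in M. \<forall>t\<ge>0. Y t \<omega> = (\<Sum>n | (\<Sum>k\<le>n. E k \<omega>) \<le> t. \<xi> n \<omega>)"
    by (auto simp: rate1_simple_random_walk_def)
  have Y_meas: "Y t \<in> measurable M (count_space UNIV)" if "t \<ge> 0" for t
    using walk that by (simp add: rate1_simple_random_walk_def)
  have rc: "continuous (at_right t) (\<lambda>u. Y u \<omega>)" if "t \<ge> 0" "\<omega> \<in> space M" for t \<omega>
    using walk that by (simp add: rate1_simple_random_walk_def)
  have pos: "AE \<omega> in M. \<forall>k. 0 < E k \<omega>"
    using driver AE_exponential_pos unfolding walk_driver_def AE_all_countable by blast
  have "{\<omega>\<in>space M. \<tau> \<omega> > ereal s} = {\<omega>\<in>space M. \<exists>m::nat. \<forall>q::rat.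
      0 \<le> q \<and> of_rat q < s + 1 / Suc m \<longrightarrow> \<bar>Y (of_rat q) \<omega>\<bar> \<noteq> int l}"
    using gt_hitting_time_iff[OF s rc] unfolding tau by blast
  also have "\<dots> \<in> events"
  proof -
    have "Measurable.pred M (\<lambda>\<omega>. 0 \<le> q \<and> of_rat q < s + 1 / Suc m \<longrightarrow> \<bar>Y (of_rat q) \<omega>\<bar> \<noteq> int l)"
      for q :: rat and m :: nat
    proof (cases "0 \<le> q")
      case True
      then have [measurable]: "Y (of_rat q) \<in> measurable M (count_space UNIV)"
        by (intro Y_meas) simp
      show ?thesis by measurable
    qed simp
    then have "Measurable.pred M (\<lambda>\<omega>. \<exists>m::nat. \<forall>q::rat.
        0 \<le> q \<and> of_rat q < s + 1 / Suc m \<longrightarrow> \<bar>Y (of_rat q) \<omega>\<bar> \<noteq> int l)"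
      by (intro pred_intros_countable)
    then show ?thesis by (rule predE)
  qed
  finally have ev: "{\<omega>\<in>space M. \<tau> \<omega> > ereal s} \<in> events" .
  have "exp (- (1 - cos (pi / (2 * real l))) * s) \<le> \<P>(\<omega> in M. \<tau> \<omega> > ereal s)"
  proof (rule prob_ge_poisson_mixture[OF driver s l ev])
    fix n
    show "AE \<omega> in M. (\<Sum>k<n. E k \<omega>) \<le> s \<and> s < (\<Sum>k<Suc n. E k \<omega>) \<and>
      confined l n (\<lambda>i. \<xi> i \<omega>) \<longrightarrow> \<omega> \<in> {\<omega>\<in>space M. \<tau> \<omega> > ereal s}"
      using Y pos AE_space
    proof eventually_elim
      case (elim \<omega>)
      then show ?case
        using hitting_time_confined_gt[of "\<lambda>k. E k \<omega>" "\<lambda>t. Y t \<omega>" "\<lambda>n. \<xi> n \<omega>" s n l]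
        by (auto simp: tau less_imp_le)
    qed
  qed
  then show "\<P>(\<omega> in M. \<tau> \<omega> > ereal s) \<ge> exp (- lam * s)"
    by (simp add: lam theta)
  have "lam \<le> \<theta>\<^sup>2 / 2"
    unfolding lam by (rule one_minus_cos_le)
  also have "\<dots> = (1 / 8) * (pi / real l)\<^sup>2"
    by (simp add: theta power2_eq_square)
  finally have "lam * s \<le> (1 / 8) * (pi / real l)\<^sup>2 * s"
    using s by (rule mult_right_mono)
  then show "exp (- lam * s) \<ge> exp (- (1 / 8) * s * (pi / real l)\<^sup>2)"
    by (simp add: mult_ac)
qed

end
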